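(* Let $S$ be an r-NA monoid. Then for every NA valued field $(\mathbb F,|\cdot|)$ there exists an ultra-normed $\mathbb F$-vector space $(V,\|\cdot\|)$ such that $S$ is a topological submonoid of $\Theta_{lin}(V)$.
   Context: A topological monoid is a monoid with a Tychonoff topology for which multiplication is jointly continuous. "Topological submonoid" is meant up to an embedding of topological monoids, i.e. an injective identity-preserving homomorphism which is a homeomorphism onto its image. A Stone space is a compact Hausdorff space with a base of clopen sets. A topological monoid $S$ is r-NA (right non-archimedean) if there are a Stone space $Y$, a jointly continuous right monoid action $Y\times S\to Y$ (with $e_S$ acting as the identity), and a topological embedding $\nu:S\hookrightarrow Y$ with dense image such that $\nu(ts)=\nu(t)s$ for all $s,t\in S$. An NA valued field is a field $\mathbb F$ with an absolute value $|\cdot|:\mathbb F\to[0,\infty)$ (multiplicative, with $|x|=0$ iff $x=0$) satisfying $|x+y|\le\max\{|x|,|y|\}$. An ultra-norm on an $\mathbb F$-vector space $V$ is a function $\|\cdot\|:V\to[0,\infty)$ with $\|v\|=0$ iff $v=0$, $\|\lambda v\|=|\lambda|\,\|v\|$ and $\|u+v\|\le\max\{\|u\|,\|v\|\}$. $\Theta_{lin}(V)$ is the topological monoid, under composition, of all $\mathbb F$-linear maps $\sigma:V\to V$ with $\|\sigma(v)\|\le\|v\|$ for all $v\in V$, equipped with the pointwise topology (inherited from $V^V$, where $V$ has the norm topology). *)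

theory Defs
  imports "HOL-Analysis.Analysis" "HOL-Algebra.Module"
begin

text \<open>
  Both parent sessions provide constants called \<open>monoid\<close>, \<open>field\<close> and \<open>module\<close>; the
  qualified names below all denote the carrier-based locales of HOL-Algebra.
\<close>

definition topological_monoid :: "('a, 'm) monoid_scheme \<Rightarrow> 'a topology \<Rightarrow> bool" where
  "topological_monoid S T \<longleftrightarrow>
     Group.monoid S \<and> topspace T = carrier S \<and>
     completely_regular_space T \<and> Hausdorff_space T \<and>
     continuous_map (prod_topology T T) T (\<lambda>(s, t). s \<otimes>\<^bsub>S\<^esub> t)"

definition topological_submonoid ::
  "('a, 'm) monoid_scheme \<Rightarrow> 'a topology \<Rightarrow> ('b, 'n) monoid_scheme \<Rightarrow> 'b topology \<Rightarrow> bool" where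
  "topological_submonoid S T S' T' \<longleftrightarrow>
     (\<exists>\<phi>. \<phi> \<in> hom S S' \<and> \<phi> \<one>\<^bsub>S\<^esub> = \<one>\<^bsub>S'\<^esub> \<and> embedding_map T T' \<phi>)"

definition Stone_space :: "'y topology \<Rightarrow> bool" where
  "Stone_space Y \<longleftrightarrow>
     compact_space Y \<and> Hausdorff_space Y \<and>
     (\<exists>\<B>. (\<forall>B\<in>\<B>. openin Y B \<and> closedin Y B) \<and> openin Y = arbitrary union_of (\<lambda>B. B \<in> \<B>))"

definition continuous_right_action ::
  "('a, 'm) monoid_scheme \<Rightarrow> 'a topology \<Rightarrow> 'y topology \<Rightarrow> ('y \<Rightarrow> 'a \<Rightarrow> 'y) \<Rightarrow> bool" where
  "continuous_right_action S T Y act \<longleftrightarrow>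
     continuous_map (prod_topology Y T) Y (\<lambda>(y, s). act y s) \<and>
     (\<forall>y\<in>topspace Y. act y \<one>\<^bsub>S\<^esub> = y) \<and>
     (\<forall>y\<in>topspace Y. \<forall>s\<in>carrier S. \<forall>t\<in>carrier S. act (act y s) t = act y (s \<otimes>\<^bsub>S\<^esub> t))"

text \<open>
  HOL cannot quantify over types inside a formula, so the type in which the points of the
  Stone space live is a parameter. A hypothesis \<open>r_NA TYPE('y) S T\<close> with a free type variable
  \<open>'y\<close> therefore admits every Stone space.
\<close>

definition r_NA :: "'y itself \<Rightarrow> ('a, 'm) monoid_scheme \<Rightarrow> 'a topology \<Rightarrow> bool" where
  "r_NA ty S T \<longleftrightarrow>
     topological_monoid S T \<and>
     (\<exists>(Y :: 'y topology) act \<nu>.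
        Stone_space Y \<and> continuous_right_action S T Y act \<and>
        embedding_map T Y \<nu> \<and> Y closure_of (\<nu> ` topspace T) = topspace Y \<and>
        (\<forall>t\<in>carrier S. \<forall>s\<in>carrier S. \<nu> (t \<otimes>\<^bsub>S\<^esub> s) = act (\<nu> t) s))"

definition NA_valued_field :: "('f, 'r) ring_scheme \<Rightarrow> ('f \<Rightarrow> real) \<Rightarrow> bool" where
  "NA_valued_field F av \<longleftrightarrow>
     Ring.field F \<and>
     (\<forall>x\<in>carrier F. 0 \<le> av x) \<and>
     (\<forall>x\<in>carrier F. av x = 0 \<longleftrightarrow> x = \<zero>\<^bsub>F\<^esub>) \<and>
     (\<forall>x\<in>carrier F. \<forall>y\<in>carrier F. av (x \<otimes>\<^bsub>F\<^esub> y) = av x * av y) \<and>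
     (\<forall>x\<in>carrier F. \<forall>y\<in>carrier F. av (x \<oplus>\<^bsub>F\<^esub> y) \<le> max (av x) (av y))"

definition ultra_normed_space ::
  "('f, 'r) ring_scheme \<Rightarrow> ('f \<Rightarrow> real) \<Rightarrow> ('f, 'v, 'x) module_scheme \<Rightarrow> ('v \<Rightarrow> real) \<Rightarrow> bool" where
  "ultra_normed_space F av V nrm \<longleftrightarrow>
     Module.module F V \<and>
     (\<forall>v\<in>carrier V. 0 \<le> nrm v) \<and>
     (\<forall>v\<in>carrier V. nrm v = 0 \<longleftrightarrow> v = \<zero>\<^bsub>V\<^esub>) \<and>
     (\<forall>c\<in>carrier F. \<forall>v\<in>carrier V. nrm (c \<odot>\<^bsub>V\<^esub> v) = av c * nrm v) \<and>
     (\<forall>u\<in>carrier V. \<forall>v\<in>carrier V. nrm (u \<oplus>\<^bsub>V\<^esub> v) \<le> max (nrm u) (nrm v))"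

text \<open>
  The locale \<open>Metric_space\<close> requires nonnegativity and symmetry for all arguments, also outside
  the carrier; hence the default value 0 there, which does not influence the topology.
\<close>

definition norm_dist :: "('f, 'v, 'x) module_scheme \<Rightarrow> ('v \<Rightarrow> real) \<Rightarrow> 'v \<Rightarrow> 'v \<Rightarrow> real" where
  "norm_dist V nrm u v =
     (if u \<in> carrier V \<and> v \<in> carrier V then nrm (u \<ominus>\<^bsub>V\<^esub> v) else 0)"

definition norm_topology :: "('f, 'v, 'x) module_scheme \<Rightarrow> ('v \<Rightarrow> real) \<Rightarrow> 'v topology" where
  "norm_topology V nrm = Metric_space.mtopology (carrier V) (norm_dist V nrm)"

text \<open>
  A map \<open>V \<rightarrow> V\<close> is represented by the HOL function that is \<open>undefined\<close> outside \<open>carrier V\<close>,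
  as in \<open>product_topology\<close>, so that equality of maps is equality of functions.
\<close>

definition Theta_lin ::
  "('f, 'r) ring_scheme \<Rightarrow> ('f, 'v, 'x) module_scheme \<Rightarrow> ('v \<Rightarrow> real) \<Rightarrow> ('v \<Rightarrow> 'v) monoid" where
  "Theta_lin F V nrm =
     \<lparr>carrier = {\<sigma> \<in> carrier V \<rightarrow>\<^sub>E carrier V.
        (\<forall>u\<in>carrier V. \<forall>v\<in>carrier V. \<sigma> (u \<oplus>\<^bsub>V\<^esub> v) = \<sigma> u \<oplus>\<^bsub>V\<^esub> \<sigma> v) \<and>
        (\<forall>c\<in>carrier F. \<forall>v\<in>carrier V. \<sigma> (c \<odot>\<^bsub>V\<^esub> v) = c \<odot>\<^bsub>V\<^esub> \<sigma> v) \<and>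
        (\<forall>v\<in>carrier V. nrm (\<sigma> v) \<le> nrm v)},
      monoid.mult = (\<lambda>\<sigma> \<tau>. compose (carrier V) \<sigma> \<tau>),
      one = (\<lambda>v\<in>carrier V. v)\<rparr>"

definition Theta_lin_topology ::
  "('f, 'r) ring_scheme \<Rightarrow> ('f, 'v, 'x) module_scheme \<Rightarrow> ('v \<Rightarrow> real) \<Rightarrow> ('v \<Rightarrow> 'v) topology" where
  "Theta_lin_topology F V nrm =
     subtopology (product_topology (\<lambda>_. norm_topology V nrm) (carrier V))
       (carrier (Theta_lin F V nrm))"

lemma Metric_space_norm_dist:
  assumes F: "NA_valued_field F av" and V: "ultra_normed_space F av V nrm"
  shows "Metric_space (carrier V) (norm_dist V nrm)"
proof -
  interpret F: Ring.field F using F by (simp add: NA_valued_field_def)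
  interpret V: Module.module F V using V by (simp add: ultra_normed_space_def)
  have av_nonneg: "0 \<le> av x" if "x \<in> carrier F" for x
    using F that by (simp add: NA_valued_field_def)
  have av_mult: "av (x \<otimes>\<^bsub>F\<^esub> y) = av x * av y" if "x \<in> carrier F" "y \<in> carrier F" for x y
    using F that by (simp add: NA_valued_field_def)
  have av_zero: "av x = 0 \<longleftrightarrow> x = \<zero>\<^bsub>F\<^esub>" if "x \<in> carrier F" for x
    using F that by (simp add: NA_valued_field_def)
  have nonneg: "0 \<le> nrm v" if "v \<in> carrier V" for v
    using V that by (simp add: ultra_normed_space_def)
  have zero: "nrm v = 0 \<longleftrightarrow> v = \<zero>\<^bsub>V\<^esub>" if "v \<in> carrier V" for v
    using V that by (simp add: ultra_normed_space_def)
  have scale: "nrm (c \<odot>\<^bsub>V\<^esub> v) = av c * nrm v" if "c \<in> carrier F" "v \<in> carrier V" for c v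
    using V that by (simp add: ultra_normed_space_def)
  have add: "nrm (u \<oplus>\<^bsub>V\<^esub> v) \<le> max (nrm u) (nrm v)" if "u \<in> carrier V" "v \<in> carrier V" for u v
    using V that by (simp add: ultra_normed_space_def)
  have one: "av \<one>\<^bsub>F\<^esub> = 1"
    using av_mult[of "\<one>\<^bsub>F\<^esub>" "\<one>\<^bsub>F\<^esub>"] av_zero[of "\<one>\<^bsub>F\<^esub>"] F.one_not_zero by simp
  have "av (\<ominus>\<^bsub>F\<^esub> \<one>\<^bsub>F\<^esub>) * av (\<ominus>\<^bsub>F\<^esub> \<one>\<^bsub>F\<^esub>) = 1"
    using av_mult[of "\<ominus>\<^bsub>F\<^esub> \<one>\<^bsub>F\<^esub>" "\<ominus>\<^bsub>F\<^esub> \<one>\<^bsub>F\<^esub>"] one by (simp add: F.l_minus F.r_minus)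
  then have m1: "av (\<ominus>\<^bsub>F\<^esub> \<one>\<^bsub>F\<^esub>) = 1"
    using av_nonneg[of "\<ominus>\<^bsub>F\<^esub> \<one>\<^bsub>F\<^esub>"] square_eq_1_iff by fastforce
  have neg: "nrm (\<ominus>\<^bsub>V\<^esub> v) = nrm v" if "v \<in> carrier V" for v
    using scale[of "\<ominus>\<^bsub>F\<^esub> \<one>\<^bsub>F\<^esub>" v] that m1 V.smult_l_minus[of "\<one>\<^bsub>F\<^esub>" v] by simp
  show ?thesis
  proof
    fix x y show "0 \<le> norm_dist V nrm x y"
      by (simp add: norm_dist_def nonneg)
    have "\<ominus>\<^bsub>V\<^esub> (x \<ominus>\<^bsub>V\<^esub> y) = y \<ominus>\<^bsub>V\<^esub> x" if "x \<in> carrier V" "y \<in> carrier V"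
      using that by (simp add: a_minus_def V.minus_add V.a_comm)
    then show "norm_dist V nrm x y = norm_dist V nrm y x"
      using neg[of "x \<ominus>\<^bsub>V\<^esub> y"] by (auto simp: norm_dist_def)
  next
    fix x y assume "x \<in> carrier V" "y \<in> carrier V"
    moreover from this have "x \<ominus>\<^bsub>V\<^esub> y = \<zero>\<^bsub>V\<^esub> \<longleftrightarrow> x = y"
      by (metis V.a_inv_closed V.minus_equality V.minus_minus V.r_neg a_minus_def)
    ultimately show "norm_dist V nrm x y = 0 \<longleftrightarrow> x = y"
      by (simp add: norm_dist_def zero)
  next
    fix x y z assume xyz: "x \<in> carrier V" "y \<in> carrier V" "z \<in> carrier V"
    have "(x \<ominus>\<^bsub>V\<^esub> y) \<oplus>\<^bsub>V\<^esub> (y \<ominus>\<^bsub>V\<^esub> z) = x \<ominus>\<^bsub>V\<^esub> z"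
      using xyz by (simp add: a_minus_def V.a_assoc V.r_neg1)
    then show "norm_dist V nrm x z \<le> norm_dist V nrm x y + norm_dist V nrm y z"
      using add[of "x \<ominus>\<^bsub>V\<^esub> y" "y \<ominus>\<^bsub>V\<^esub> z"] nonneg[of "x \<ominus>\<^bsub>V\<^esub> y"] nonneg[of "y \<ominus>\<^bsub>V\<^esub> z"] xyz
      by (simp add: norm_dist_def)
  qed
qed

end

theory Submission
  imports Defs
begin

text \<open>
  Let \<open>V\<close> be the space of all functions \<open>g \<circ> \<nu>\<close> on \<open>S\<close>, where \<open>g\<close> is a locally constant
  \<open>F\<close>-valued function on the Stone space \<open>Y\<close>, with the maximum norm. Right translation
  \<open>(s f)(t) = f (t s)\<close> makes \<open>S\<close> act on \<open>V\<close> by linear contractions, because \<open>Y\<close> carries a right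
  action extending the multiplication of \<open>S\<close>. By the tube lemma every orbit map \<open>s \<mapsto> s f\<close> is
  locally constant. Conversely, if \<open>f\<close> comes from the indicator of a clopen set \<open>C\<close>, then
  evaluating at the unit shows that \<open>\<parallel>s f - s\<^sub>0 f\<parallel> < 1\<close> forces \<open>s\<close> into the preimage of \<open>C\<close> as soon
  as \<open>s\<^sub>0\<close> lies in it, and these preimages form a base of the topology of \<open>S\<close>.
\<close>

section \<open>An embedding criterion and locally constant maps\<close>

text \<open>The hypothesis \<open>sep\<close> treats one point at a time, which suits a pointwise
  topology, where \<open>W\<close> can restrict a single coordinate. Injectivity comes from it too:
  if \<open>f x = f y\<close>, every \<open>W\<close> around \<open>f x\<close> contains
  \<open>f y\<close>, so \<open>y\<close> lies in every open set around \<open>x\<close>, against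
  the Hausdorff property.\<close>

lemma embedding_mapI:
  assumes cont: "continuous_map X Z f" and X: "Hausdorff_space X"
    and sep: "\<And>U x. openin X U \<Longrightarrow> x \<in> U \<Longrightarrow>
      \<exists>W. openin Z W \<and> f x \<in> W \<and> (\<forall>y\<in>topspace X. f y \<in> W \<longrightarrow> y \<in> U)"
  shows "embedding_map X Z f"
  unfolding embedding_map_def
proof (rule bijective_open_imp_homeomorphic_map)
  have im: "f ` topspace X \<subseteq> topspace Z"
    using cont continuous_map_image_subset_topspace by blast
  show "continuous_map X (subtopology Z (f ` topspace X)) f"
    using cont by (simp add: continuous_map_in_subtopology)
  show "f ` topspace X = topspace (subtopology Z (f ` topspace X))"
    using im by auto
  show "inj_on f (topspace X)"
  proof (rule inj_onI, rule ccontr)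
    fix x y assume xy: "x \<in> topspace X" "y \<in> topspace X" "f x = f y" "x \<noteq> y"
    then obtain U where "openin X U" "x \<in> U" "y \<notin> U"
      using X unfolding Hausdorff_space_def disjnt_iff by metis
    then show False
      using sep[of U x] xy by auto
  qed
  show "open_map X (subtopology Z (f ` topspace X)) f"
    unfolding open_map_def
  proof (intro allI impI)
    fix U assume U: "openin X U"
    show "openin (subtopology Z (f ` topspace X)) (f ` U)"
      unfolding openin_subtopology
    proof (intro exI conjI)
      \<comment> \<open>The union gathers all open sets whose preimage lies in \<open>U\<close>; by
        \<open>sep\<close> it covers the image of \<open>U\<close>.\<close>
      let ?W = "\<Union>{W. openin Z W \<and> (\<forall>y\<in>topspace X. f y \<in> W \<longrightarrow> y \<in> U)}"
      show "openin Z ?W" by blast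
      show "f ` U = ?W \<inter> f ` topspace X"
        using sep[OF U] openin_subset[OF U] by blast
    qed
  qed
qed

text \<open>The preimage of any set is a union of neighbourhoods of constancy, whatever the topology
  on \<open>Z\<close>. Hence the same lemma serves for discrete targets and for the norm
  topology.\<close>

lemma continuous_map_locally_constant:
  assumes "f \<in> topspace X \<rightarrow> topspace Z"
    and "\<And>x. x \<in> topspace X \<Longrightarrow> \<exists>U. openin X U \<and> x \<in> U \<and> (\<forall>y\<in>U. f y = f x)"
  shows "continuous_map X Z f"
  unfolding continuous_map
proof (intro conjI allI impI)
  show "f ` topspace X \<subseteq> topspace Z" using assms(1) by auto
  fix W assume "openin Z W"
  show "openin X {x \<in> topspace X. f x \<in> W}"
  proof (subst openin_subopen, intro ballI)
    fix x assume x: "x \<in> {x \<in> topspace X. f x \<in> W}"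
    then obtain U where U: "openin X U" "x \<in> U" "\<forall>y\<in>U. f y = f x"
      using assms(2) by blast
    have "y \<in> topspace X \<and> f y \<in> W" if "y \<in> U" for y
      using x that U(3) openin_subset[OF U(1)] by (metis mem_Collect_eq subsetD)
    then have "U \<subseteq> {x \<in> topspace X. f x \<in> W}" by blast
    with U show "\<exists>U. openin X U \<and> x \<in> U \<and> U \<subseteq> {x \<in> topspace X. f x \<in> W}"
      by blast
  qed
qed

text \<open>A product of two discrete spaces is discrete, so every operation \<open>h\<close> on it
  is continuous.\<close>

lemma continuous_map_discrete_binary:
  assumes "continuous_map X (discrete_topology D) f" "continuous_map X (discrete_topology D) g"
    and "\<And>a b. a \<in> D \<Longrightarrow> b \<in> D \<Longrightarrow> h a b \<in> E"
  shows "continuous_map X (discrete_topology E) (\<lambda>x. h (f x) (g x))"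
proof -
  have fg: "continuous_map X (discrete_topology (D \<times> D)) (\<lambda>x. (f x, g x))"
    using assms by (simp add: prod_topology_discrete_topology continuous_map_pairedI)
  have "continuous_map (discrete_topology (D \<times> D)) (discrete_topology E) (\<lambda>(a, b). h a b)"
    using assms(3) by (auto simp: continuous_map)
  from continuous_map_compose[OF fg this] show ?thesis
    by (simp add: o_def)
qed

text \<open>The set of pairs with \<open>h y s = h y s0\<close> is open and contains the slice over
  \<open>s0\<close>. As \<open>Y\<close> is compact, the tube lemma finds a whole tube inside it,
  hence one neighbourhood of \<open>s0\<close> that works for all \<open>y\<close>.\<close>

lemma compact_continuous_map_discrete_locally_constant:
  assumes Y: "compact_space Y"
    and h: "continuous_map (prod_topology Y T) (discrete_topology D) (\<lambda>(y, s). h y s)"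
    and s0: "s0 \<in> topspace T"
  shows "\<exists>U. openin T U \<and> s0 \<in> U \<and> (\<forall>s\<in>U. \<forall>y\<in>topspace Y. h y s = h y s0)"
proof -
  let ?P = "prod_topology Y T"
  have "continuous_map ?P ?P (\<lambda>(y, s). (y, s0))"
    using s0 by (auto simp: case_prod_unfold intro!: continuous_map_pairedI continuous_map_fst)
  from continuous_map_compose[OF this h]
  have h0: "continuous_map ?P (discrete_topology D) (\<lambda>(y, s). h y s0)"
    by (simp add: o_def case_prod_unfold)
  \<comment> \<open>Equality is used as a binary operation into the discrete booleans, so that the
    coincidence set is the preimage of \<open>{True}\<close>.\<close>
  have "continuous_map ?P (discrete_topology UNIV)
      (\<lambda>p. (\<lambda>a b. a = b) ((\<lambda>(y, s). h y s) p) ((\<lambda>(y, s). h y s0) p))"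
    by (rule continuous_map_discrete_binary[OF h h0]) simp
  then have "openin ?P {p \<in> topspace ?P.
      ((\<lambda>a b. a = b) ((\<lambda>(y, s). h y s) p) ((\<lambda>(y, s). h y s0) p)) \<in> {True}}"
    by (rule openin_continuous_map_preimage) simp
  then have op: "openin ?P {p \<in> topspace ?P. h (fst p) (snd p) = h (fst p) s0}"
    by (simp add: case_prod_unfold)
  obtain U V where "openin Y U" "openin T V" "topspace Y \<subseteq> U" "s0 \<in> V"
      "U \<times> V \<subseteq> {p \<in> topspace ?P. h (fst p) (snd p) = h (fst p) s0}"
    using tube_lemma_left[OF op Y[unfolded compact_space_def] s0] s0 by fastforce
  then have "\<forall>s\<in>V. \<forall>y\<in>topspace Y. h y s = h y s0"
    by fastforce
  then show ?thesis
    using \<open>openin T V\<close> \<open>s0 \<in> V\<close> by blast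
qed

section \<open>Modules of functions with pointwise operations\<close>

text \<open>Restriction to \<open>A\<close> makes equality on \<open>A\<close> the same as equality
  of functions. The record extends that of rings, whose product and unit have no counterpart in a
  vector space and are left \<open>undefined\<close>.\<close>

definition function_module :: "('f, 'r) ring_scheme \<Rightarrow> 'a set \<Rightarrow> ('a \<Rightarrow> 'f) set \<Rightarrow> ('f, 'a \<Rightarrow> 'f) module"
  where "function_module F A W =
    \<lparr>carrier = W, monoid.mult = undefined, one = undefined,
     zero = (\<lambda>a\<in>A. \<zero>\<^bsub>F\<^esub>), add = (\<lambda>f g. \<lambda>a\<in>A. f a \<oplus>\<^bsub>F\<^esub> g a),
     smult = (\<lambda>c f. \<lambda>a\<in>A. c \<otimes>\<^bsub>F\<^esub> f a)\<rparr>"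

lemma function_module_simps [simp]:
  "carrier (function_module F A W) = W"
  "\<zero>\<^bsub>function_module F A W\<^esub> = (\<lambda>a\<in>A. \<zero>\<^bsub>F\<^esub>)"
  "f \<oplus>\<^bsub>function_module F A W\<^esub> g = (\<lambda>a\<in>A. f a \<oplus>\<^bsub>F\<^esub> g a)"
  "c \<odot>\<^bsub>function_module F A W\<^esub> f = (\<lambda>a\<in>A. c \<otimes>\<^bsub>F\<^esub> f a)"
  by (simp_all add: function_module_def)

definition function_subspace :: "('f, 'r) ring_scheme \<Rightarrow> 'a set \<Rightarrow> ('a \<Rightarrow> 'f) set \<Rightarrow> bool" where
  "function_subspace F A W \<longleftrightarrow>
     W \<subseteq> A \<rightarrow>\<^sub>E carrier F \<and> (\<lambda>a\<in>A. \<zero>\<^bsub>F\<^esub>) \<in> W \<and>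
     (\<forall>f\<in>W. \<forall>g\<in>W. (\<lambda>a\<in>A. f a \<oplus>\<^bsub>F\<^esub> g a) \<in> W) \<and>
     (\<forall>c\<in>carrier F. \<forall>f\<in>W. (\<lambda>a\<in>A. c \<otimes>\<^bsub>F\<^esub> f a) \<in> W)"

lemma module_function_module:
  assumes "Ring.cring F" and W: "function_subspace F A W"
  shows "Module.module F (function_module F A W)"
proof -
  interpret F: Ring.cring F by fact
  have val: "f a \<in> carrier F" if "f \<in> W" "a \<in> A" for f a
    using W that by (auto simp: function_subspace_def)
  have ext: "(\<lambda>a\<in>A. f a) = f" if "f \<in> W" for f
    using W that by (auto simp: function_subspace_def PiE_def extensional_restrict)
  note closed = W[unfolded function_subspace_def]
  show ?thesis
  proof (rule Module.moduleI)
    show "abelian_group (function_module F A W)"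
    proof (rule abelian_groupI)
      fix f assume f: "f \<in> carrier (function_module F A W)"
      show "\<zero>\<^bsub>function_module F A W\<^esub> \<oplus>\<^bsub>function_module F A W\<^esub> f = f"
        using f val ext[of f] by (auto cong: restrict_cong)
      show "\<exists>g\<in>carrier (function_module F A W). g \<oplus>\<^bsub>function_module F A W\<^esub> f = \<zero>\<^bsub>function_module F A W\<^esub>"
      proof
        \<comment> \<open>The additive inverse is written as a multiple by minus one, so that
          closure under scalars puts it into \<open>W\<close>.\<close>
        show "(\<lambda>a\<in>A. (\<ominus>\<^bsub>F\<^esub> \<one>\<^bsub>F\<^esub>) \<otimes>\<^bsub>F\<^esub> f a) \<in> carrier (function_module F A W)"
          using f closed by (metis F.a_inv_closed F.one_closed function_module_simps(1))
      qed (use f val in \<open>auto simp: F.l_minus F.l_neg intro!: restrict_ext\<close>)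
    next
      fix f g assume "f \<in> carrier (function_module F A W)" "g \<in> carrier (function_module F A W)"
      then show "f \<oplus>\<^bsub>function_module F A W\<^esub> g = g \<oplus>\<^bsub>function_module F A W\<^esub> f"
        using val by (auto simp: F.a_comm intro!: restrict_ext)
    next
      fix f g h assume "f \<in> carrier (function_module F A W)" "g \<in> carrier (function_module F A W)"
        "h \<in> carrier (function_module F A W)"
      then show "f \<oplus>\<^bsub>function_module F A W\<^esub> g \<oplus>\<^bsub>function_module F A W\<^esub> h =
          f \<oplus>\<^bsub>function_module F A W\<^esub> (g \<oplus>\<^bsub>function_module F A W\<^esub> h)"
        using val by (auto simp: F.a_assoc intro!: restrict_ext)
    qed (use closed in simp_all)
  next
    fix f assume "f \<in> carrier (function_module F A W)"
    then show "\<one>\<^bsub>F\<^esub> \<odot>\<^bsub>function_module F A W\<^esub> f = f"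
      using val ext[of f] by (auto cong: restrict_cong)
  qed (use closed val assms(1) in
      \<open>simp_all add: F.l_distr F.r_distr F.m_assoc cong: restrict_cong\<close>)
qed

section \<open>The maximum norm\<close>

text \<open>The maximum is taken over the set of values, so \<open>A\<close> may be infinite as long
  as it is nonempty and \<open>f\<close> has finite range. Compactness of the Stone space will
  supply the finiteness.\<close>

definition max_norm :: "('f \<Rightarrow> real) \<Rightarrow> 'a set \<Rightarrow> ('a \<Rightarrow> 'f) \<Rightarrow> real" where
  "max_norm av A f = Max ((\<lambda>a. av (f a)) ` A)"

lemma max_norm_le_iff:
  assumes "finite (f ` A)" "A \<noteq> {}"
  shows "max_norm av A f \<le> r \<longleftrightarrow> (\<forall>a\<in>A. av (f a) \<le> r)"
proof -
  have "finite ((\<lambda>a. av (f a)) ` A)"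
    using assms(1) by (metis finite_imageI image_image)
  then show ?thesis using assms(2) by (simp add: max_norm_def)
qed

lemma max_norm_ge:
  assumes "finite (f ` A)" "a \<in> A"
  shows "av (f a) \<le> max_norm av A f"
proof -
  have "A \<noteq> {}" using assms(2) by blast
  from max_norm_le_iff[OF assms(1) this, of av "max_norm av A f"] show ?thesis
    using assms(2) by simp
qed

lemma max_norm_attained:
  assumes "finite (f ` A)" "A \<noteq> {}"
  shows "\<exists>a\<in>A. max_norm av A f = av (f a)"
proof -
  have "finite ((\<lambda>a. av (f a)) ` A)"
    using assms(1) by (metis finite_imageI image_image)
  then have "max_norm av A f \<in> (\<lambda>a. av (f a)) ` A"
    using assms(2) unfolding max_norm_def by (intro Max_in) auto
  then show ?thesis by auto
qed

text \<open>The axioms are inherited from \<open>av\<close> at points. Upper bounds are checked at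
  every point; the lower bound in homogeneity is read off at a point where \<open>f\<close> attains
  its maximum.\<close>

lemma ultra_normed_space_function_module:
  assumes F: "NA_valued_field F av" and W: "function_subspace F A W"
    and fin: "\<And>f. f \<in> W \<Longrightarrow> finite (f ` A)" and A: "A \<noteq> {}"
  shows "ultra_normed_space F av (function_module F A W) (max_norm av A)"
proof -
  interpret F: Ring.field F using F by (simp add: NA_valued_field_def)
  note av = F[unfolded NA_valued_field_def]
  have val: "f a \<in> carrier F" if "f \<in> W" "a \<in> A" for f a
    using W that by (auto simp: function_subspace_def)
  have ext: "f \<in> extensional A" if "f \<in> W" for f
    using W that by (auto simp: function_subspace_def PiE_def)
  note closed = W[unfolded function_subspace_def]
  note attained = max_norm_attained[OF fin A, where av = av]
  note ge = max_norm_ge[OF fin, where av = av]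
  have nonneg: "0 \<le> max_norm av A f" if "f \<in> W" for f
    using attained[OF that] val[OF that] av by auto
  show ?thesis
    unfolding ultra_normed_space_def function_module_simps
  proof (intro conjI ballI)
    show "Module.module F (function_module F A W)"
      using module_function_module[OF F.is_cring W] .
  next
    fix f assume "f \<in> W" then show "0 \<le> max_norm av A f" by (rule nonneg)
  next
    fix f assume f: "f \<in> W"
    show "max_norm av A f = 0 \<longleftrightarrow> f = (\<lambda>a\<in>A. \<zero>\<^bsub>F\<^esub>)"
    proof
      assume 0: "max_norm av A f = 0"
      have "f a = \<zero>\<^bsub>F\<^esub>" if "a \<in> A" for a
      proof -
        have "av (f a) = 0"
          using ge[OF f that] val[OF f that] av 0 by (simp add: order_antisym)
        then show ?thesis using val[OF f that] av by blast
      qed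
      then show "f = (\<lambda>a\<in>A. \<zero>\<^bsub>F\<^esub>)"
        using ext[OF f] by (intro extensionalityI[where A = A]) simp_all
    next
      assume 0: "f = (\<lambda>a\<in>A. \<zero>\<^bsub>F\<^esub>)"
      obtain a where "a \<in> A" "max_norm av A f = av (f a)"
        using attained[OF f] by blast
      then show "max_norm av A f = 0"
        using 0 av by simp
    qed
  next
    fix c f assume c: "c \<in> carrier F" and f: "f \<in> W"
    let ?cf = "\<lambda>a\<in>A. c \<otimes>\<^bsub>F\<^esub> f a"
    have cf: "?cf \<in> W" using closed c f by blast
    have eq: "av (?cf a) = av c * av (f a)" if "a \<in> A" for a
      using that av c val[OF f] by simp
    show "max_norm av A ?cf = av c * max_norm av A f"
    proof (rule antisym)
      show "max_norm av A ?cf \<le> av c * max_norm av A f"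
        using max_norm_le_iff[OF fin[OF cf] A] eq ge[OF f] av c
        by (simp add: mult_left_mono)
      show "av c * max_norm av A f \<le> max_norm av A ?cf"
        using attained[OF f] eq ge[OF cf] by metis
    qed
  next
    fix f g assume f: "f \<in> W" and g: "g \<in> W"
    let ?fg = "\<lambda>a\<in>A. f a \<oplus>\<^bsub>F\<^esub> g a"
    have fg: "?fg \<in> W" using closed f g by blast
    have "av (?fg a) \<le> max (max_norm av A f) (max_norm av A g)" if a: "a \<in> A" for a
    proof -
      have "av (?fg a) \<le> max (av (f a)) (av (g a))"
        using av val[OF f a] val[OF g a] a by simp
      also have "\<dots> \<le> max (max_norm av A f) (max_norm av A g)"
        using ge[OF f a] ge[OF g a] by linarith
      finally show ?thesis .
    qed
    then show "max_norm av A ?fg \<le> max (max_norm av A f) (max_norm av A g)"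
      using max_norm_le_iff[OF fin[OF fg] A] by blast
  qed
qed

section \<open>Locally constant functions pulled back from a Stone space\<close>

text \<open>Continuity into a discrete space encodes local constancy. Composing with \<nu> places
  the vectors in the type \<open>'a \<Rightarrow> 'f\<close>, in which the type of the points of
  \<open>Y\<close> does not occur.\<close>

definition pullback_functions ::
  "'f set \<Rightarrow> 'a set \<Rightarrow> 'y topology \<Rightarrow> ('a \<Rightarrow> 'y) \<Rightarrow> ('a \<Rightarrow> 'f) set" where
  "pullback_functions D A Y \<nu> =
     {\<lambda>a\<in>A. g (\<nu> a) | g. continuous_map Y (discrete_topology D) g}"

lemma function_subspace_pullback_functions:
  assumes "Ring.cring F" and "\<nu> \<in> A \<rightarrow> topspace Y"
  shows "function_subspace F A (pullback_functions (carrier F) A Y \<nu>)"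
proof -
  interpret F: Ring.cring F by fact
  let ?D = "discrete_topology (carrier F)"
  let ?W = "pullback_functions (carrier F) A Y \<nu>"
  have "?W \<subseteq> A \<rightarrow>\<^sub>E carrier F"
    using assms(2) by (fastforce simp: pullback_functions_def continuous_map_def)
  moreover have "(\<lambda>a\<in>A. \<zero>\<^bsub>F\<^esub>) \<in> ?W"
    unfolding pullback_functions_def mem_Collect_eq
    by (rule exI[of _ "\<lambda>_. \<zero>\<^bsub>F\<^esub>"]) simp
  moreover have "(\<lambda>a\<in>A. f a \<oplus>\<^bsub>F\<^esub> f' a) \<in> ?W" if W: "f \<in> ?W" "f' \<in> ?W" for f f'
  proof -
    obtain g g' where g: "continuous_map Y ?D g" "continuous_map Y ?D g'"
      "f = (\<lambda>a\<in>A. g (\<nu> a))" "f' = (\<lambda>a\<in>A. g' (\<nu> a))"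
      using W by (auto simp: pullback_functions_def)
    have "continuous_map Y ?D (\<lambda>y. g y \<oplus>\<^bsub>F\<^esub> g' y)"
      by (rule continuous_map_discrete_binary[OF g(1,2)]) simp
    then show ?thesis
      unfolding pullback_functions_def mem_Collect_eq using g(3,4)
      by (intro exI[of _ "\<lambda>y. g y \<oplus>\<^bsub>F\<^esub> g' y"]) (simp cong: restrict_cong)
  qed
  moreover have "(\<lambda>a\<in>A. c \<otimes>\<^bsub>F\<^esub> f a) \<in> ?W" if c: "c \<in> carrier F" and W: "f \<in> ?W" for c f
  proof -
    obtain g where g: "continuous_map Y ?D g" "f = (\<lambda>a\<in>A. g (\<nu> a))"
      using W by (auto simp: pullback_functions_def)
    \<comment> \<open>Scaling is fitted to the binary lemma as an operation that ignores its second
      argument.\<close>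
    have "continuous_map Y ?D (\<lambda>y. c \<otimes>\<^bsub>F\<^esub> g y)"
      using continuous_map_discrete_binary[OF g(1) g(1), of "\<lambda>a b. c \<otimes>\<^bsub>F\<^esub> a"] c by simp
    then show ?thesis
      unfolding pullback_functions_def mem_Collect_eq using g(2)
      by (intro exI[of _ "\<lambda>y. c \<otimes>\<^bsub>F\<^esub> g y"]) (simp cong: restrict_cong)
  qed
  ultimately show ?thesis by (simp add: function_subspace_def)
qed

text \<open>The image of the compact space \<open>Y\<close> in a discrete space is compact, hence
  finite.\<close>

lemma finite_range_pullback_functions:
  assumes "compact_space Y" and "\<nu> \<in> A \<rightarrow> topspace Y" and "f \<in> pullback_functions D A Y \<nu>"
  shows "finite (f ` A)"
proof -
  obtain g where g: "continuous_map Y (discrete_topology D) g" "f = (\<lambda>a\<in>A. g (\<nu> a))"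
    using assms(3) by (auto simp: pullback_functions_def)
  have "compactin (discrete_topology D) (g ` topspace Y)"
    using assms(1) g(1) image_compactin by (metis compact_space_def)
  then have "finite (g ` topspace Y)"
    by (simp add: compactin_discrete_topology)
  moreover have "f ` A \<subseteq> g ` topspace Y" using assms(2) g(2) by auto
  ultimately show ?thesis by (rule rev_finite_subset)
qed

lemma Stone_space_clopen_nbhd:
  assumes "Stone_space Y" "openin Y U" "y \<in> U"
  obtains C where "openin Y C" "closedin Y C" "y \<in> C" "C \<subseteq> U"
proof -
  obtain B where B: "\<forall>C\<in>B. openin Y C \<and> closedin Y C"
    and "openin Y = arbitrary union_of (\<lambda>C. C \<in> B)"
    using assms(1) by (auto simp: Stone_space_def)
  then obtain \<U> where "\<U> \<subseteq> B" "\<Union>\<U> = U"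
    using assms(2) by (auto simp: union_of_def arbitrary_def)
  then show ?thesis using that B assms(3) by blast
qed

lemma continuous_map_clopen_indicator:
  assumes "openin Y C" "closedin Y C" "a \<in> D" "b \<in> D"
  shows "continuous_map Y (discrete_topology D) (\<lambda>y. if y \<in> C then a else b)"
proof (rule continuous_map_locally_constant)
  fix x assume x: "x \<in> topspace Y"
  show "\<exists>U. openin Y U \<and> x \<in> U \<and>
      (\<forall>y\<in>U. (if y \<in> C then a else b) = (if x \<in> C then a else b))"
  proof (cases "x \<in> C")
    case True then show ?thesis using assms(1) by (intro exI[of _ C]) auto
  next
    case False then show ?thesis
      using assms(2) x by (intro exI[of _ "topspace Y - C"]) auto
  qed
qed (use assms in auto)

section \<open>The embedding by right translation\<close>

theorem proposition5p18:
  fixes S :: "('a, 'm) monoid_scheme" and T :: "'a topology"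
    and F :: "('f, 'r) ring_scheme" and av :: "'f \<Rightarrow> real"
  assumes "r_NA TYPE('y) S T"
    and "NA_valued_field F av"
  shows "\<exists>(V :: ('f, 'a \<Rightarrow> 'f) module) nrm.
           ultra_normed_space F av V nrm \<and>
           topological_submonoid S T (Theta_lin F V nrm) (Theta_lin_topology F V nrm)"
proof -
  note F = assms(2)
  interpret F: Ring.field F using F by (simp add: NA_valued_field_def)
  note av = F[unfolded NA_valued_field_def]
  have av_one: "av \<one>\<^bsub>F\<^esub> = 1"
  proof -
    have "av \<one>\<^bsub>F\<^esub> = av \<one>\<^bsub>F\<^esub> * av \<one>\<^bsub>F\<^esub>" "av \<one>\<^bsub>F\<^esub> \<noteq> 0"
      using av F.one_not_zero F.one_closed F.r_one by metis+
    then show ?thesis by simp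
  qed
  have S: "topological_monoid S T" using assms(1) by (simp add: r_NA_def)
  interpret S: Group.monoid S using S by (simp add: topological_monoid_def)
  have T: "topspace T = carrier S" "Hausdorff_space T"
    using S by (simp_all add: topological_monoid_def)
  obtain Y :: "'y topology" and act \<nu> where Y: "Stone_space Y"
    and act: "continuous_right_action S T Y act" and emb: "embedding_map T Y \<nu>"
    and equiv: "\<And>t s. t \<in> carrier S \<Longrightarrow> s \<in> carrier S \<Longrightarrow> \<nu> (t \<otimes>\<^bsub>S\<^esub> s) = act (\<nu> t) s"
    using assms(1) unfolding r_NA_def by blast
  have compact: "compact_space Y" using Y by (simp add: Stone_space_def)
  have act_cont: "continuous_map (prod_topology Y T) Y (\<lambda>(y, s). act y s)"
    using act by (simp add: continuous_right_action_def)
  have \<nu>: "\<nu> \<in> carrier S \<rightarrow> topspace Y"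
    using emb T unfolding embedding_map_def
    by (auto dest!: homeomorphic_imp_continuous_map simp: continuous_map_in_subtopology continuous_map_def)
  have act1: "continuous_map Y Y (\<lambda>y. act y s)" if "s \<in> carrier S" for s
  proof -
    have "continuous_map Y (prod_topology Y T) (\<lambda>y. (y, s))"
      using that T by (intro continuous_map_pairedI) auto
    from continuous_map_compose[OF this act_cont] show ?thesis by (simp add: o_def)
  qed

  let ?D = "discrete_topology (carrier F)"
  define A where "A = carrier S"
  define W where "W = pullback_functions (carrier F) A Y \<nu>"
  define V where "V = function_module F A W"
  define nrm where "nrm = max_norm av A"
  \<comment> \<open>The outer restriction gives maps that are extensional on \<open>W\<close>, as
    \<open>Theta_lin\<close> demands; the inner one keeps each translate extensional on
    \<open>A\<close>.\<close>
  define \<phi> where "\<phi> s = (\<lambda>f\<in>W. \<lambda>t\<in>A. f (t \<otimes>\<^bsub>S\<^esub> s))" for s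
  have A: "A \<noteq> {}" using S.one_closed by (auto simp: A_def)
  have subspace: "function_subspace F A W"
    unfolding W_def A_def by (intro function_subspace_pullback_functions F.is_cring \<nu>)
  have fin: "finite (f ` A)" if "f \<in> W" for f
    using finite_range_pullback_functions[OF compact \<nu>] that by (simp add: W_def A_def)
  have V: "ultra_normed_space F av V nrm"
    unfolding V_def nrm_def by (rule ultra_normed_space_function_module[OF F subspace fin A])
  interpret V: Module.module F V using V by (simp add: ultra_normed_space_def)
  interpret M: Metric_space "carrier V" "norm_dist V nrm"
    by (rule Metric_space_norm_dist[OF F V])
  have carrier_V: "carrier V = W" by (simp add: V_def)
  note closed = subspace[unfolded function_subspace_def]
  have ext: "f \<in> extensional A" if "f \<in> W" for f
    using closed that by (auto simp: PiE_def)
  have topspace_V: "topspace (norm_topology V nrm) = W"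
    using M.topspace_mtopology by (simp only: norm_topology_def carrier_V)

  \<comment> \<open>By equivariance of \<nu>, translating the pullback of \<open>g\<close> gives the
    pullback of \<open>g\<close> composed with the action of \<open>s\<close> on \<open>Y\<close>,
    which is again locally constant.\<close>
  have \<phi>_closed: "\<phi> s f \<in> W" if s: "s \<in> carrier S" and f: "f \<in> W" for s f
  proof -
    obtain g where g: "continuous_map Y ?D g" "f = (\<lambda>a\<in>A. g (\<nu> a))"
      using f by (auto simp: W_def pullback_functions_def)
    have "continuous_map Y ?D (\<lambda>y. g (act y s))"
      using continuous_map_compose[OF act1[OF s] g(1)] by (simp add: o_def)
    moreover have "\<phi> s f = (\<lambda>t\<in>A. g (act (\<nu> t) s))"
      using f g(2) s equiv by (auto simp: \<phi>_def A_def cong: restrict_cong)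
    ultimately show ?thesis by (auto simp: W_def pullback_functions_def)
  qed
  have \<phi>_Theta: "\<phi> s \<in> carrier (Theta_lin F V nrm)" if s: "s \<in> carrier S" for s
  proof -
    \<comment> \<open>Every value of the translate is a value of \<open>f\<close>, so the maximum
      cannot grow.\<close>
    have "nrm (\<phi> s f) \<le> nrm f" if f: "f \<in> W" for f
      unfolding nrm_def max_norm_le_iff[OF fin[OF \<phi>_closed[OF s f]] A]
      using f s max_norm_ge[OF fin[OF f]] by (auto simp: \<phi>_def A_def)
    moreover have "\<phi> s (f \<oplus>\<^bsub>V\<^esub> g) = \<phi> s f \<oplus>\<^bsub>V\<^esub> \<phi> s g" if "f \<in> W" "g \<in> W" for f g
      using that s closed by (auto simp: \<phi>_def V_def A_def cong: restrict_cong)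
    moreover have "\<phi> s (c \<odot>\<^bsub>V\<^esub> f) = c \<odot>\<^bsub>V\<^esub> \<phi> s f" if "c \<in> carrier F" "f \<in> W" for c f
      using that s closed by (auto simp: \<phi>_def V_def A_def cong: restrict_cong)
    moreover have "\<phi> s \<in> W \<rightarrow>\<^sub>E W"
      using \<phi>_closed[OF s] by (auto simp: \<phi>_def)
    ultimately show ?thesis by (simp add: Theta_lin_def carrier_V)
  qed
  have "\<phi> (s \<otimes>\<^bsub>S\<^esub> s') = \<phi> s \<otimes>\<^bsub>Theta_lin F V nrm\<^esub> \<phi> s'"
    if s: "s \<in> carrier S" "s' \<in> carrier S" for s s'
  proof -
    \<comment> \<open>Both sides send \<open>t\<close> to \<open>f\<close> at the product of
      \<open>t\<close>, \<open>s\<close> and \<open>s'\<close>: acting on the argument from the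
      right preserves the order of composition.\<close>
    have "\<phi> (s \<otimes>\<^bsub>S\<^esub> s') f = \<phi> s (\<phi> s' f)" if "f \<in> W" for f
      using s that \<phi>_closed[OF s(2) that]
      by (auto simp: \<phi>_def A_def S.m_assoc intro!: restrict_ext)
    then show ?thesis
      by (auto simp: Theta_lin_def carrier_V compose_def fun_eq_iff \<phi>_def)
  qed
  then have hom: "\<phi> \<in> hom S (Theta_lin F V nrm)"
    using \<phi>_Theta by (auto simp: hom_def)
  have one: "\<phi> \<one>\<^bsub>S\<^esub> = \<one>\<^bsub>Theta_lin F V nrm\<^esub>"
  proof -
    have "(\<lambda>t\<in>A. f (t \<otimes>\<^bsub>S\<^esub> \<one>\<^bsub>S\<^esub>)) = f" if "f \<in> W" for f
      using ext[OF that] by (auto simp: A_def fun_eq_iff extensional_def)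
    then show ?thesis
      by (auto simp: \<phi>_def Theta_lin_def carrier_V intro!: restrict_ext)
  qed

  have orbit: "continuous_map T (norm_topology V nrm) (\<lambda>s. \<phi> s f)" if f: "f \<in> W" for f
  proof (rule continuous_map_locally_constant)
    show "(\<lambda>s. \<phi> s f) \<in> topspace T \<rightarrow> topspace (norm_topology V nrm)"
      using \<phi>_closed[OF _ f] by (simp add: T topspace_V)
    fix s0 assume s0: "s0 \<in> topspace T"
    obtain g where g: "continuous_map Y ?D g" "f = (\<lambda>a\<in>A. g (\<nu> a))"
      using f by (auto simp: W_def pullback_functions_def)
    have "continuous_map (prod_topology Y T) ?D (\<lambda>(y, s). g (act y s))"
      using continuous_map_compose[OF act_cont g(1)] by (simp add: o_def case_prod_unfold)
    from compact_continuous_map_discrete_locally_constant[OF compact this s0]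
    obtain U where U: "openin T U" "s0 \<in> U"
      "\<forall>s\<in>U. \<forall>y\<in>topspace Y. g (act y s) = g (act y s0)" by blast
    \<comment> \<open>The tube controls all points of \<open>Y\<close> at once, in particular all
      \<nu>-images of \<open>S\<close>. So the translates are equal, not merely close in
      norm.\<close>
    have "\<phi> s f = \<phi> s0 f" if s: "s \<in> U" for s
    proof -
      have "s \<in> carrier S" "s0 \<in> carrier S" using s s0 openin_subset[OF U(1)] T by auto
      then show ?thesis
        using f g(2) equiv U(3) s \<nu> by (auto simp: \<phi>_def A_def Pi_iff intro!: restrict_ext)
    qed
    then show "\<exists>U. openin T U \<and> s0 \<in> U \<and> (\<forall>s\<in>U. \<phi> s f = \<phi> s0 f)"
      using U by blast
  qed
  have cont: "continuous_map T (Theta_lin_topology F V nrm) \<phi>"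
    unfolding Theta_lin_topology_def continuous_map_in_subtopology continuous_map_componentwise
    using orbit \<phi>_Theta by (auto simp: T carrier_V \<phi>_def)

  have "embedding_map T (Theta_lin_topology F V nrm) \<phi>"
  proof (rule embedding_mapI[OF cont T(2)])
    fix U s0 assume U: "openin T U" and s0: "s0 \<in> U"
    then have s0S: "s0 \<in> carrier S" using openin_subset T by auto
    have "openin (subtopology Y (\<nu> ` topspace T)) (\<nu> ` U)"
      using emb U s0 unfolding embedding_map_def
      by (metis homeomorphic_map_openness_eq)
    \<comment> \<open>Clopen sets are available in \<open>Y\<close>, not in the image of \<nu>, so
      the image of \<open>U\<close> is first extended to an open set of \<open>Y\<close>.\<close>
    then obtain O' where O': "openin Y O'" "\<nu> ` U = O' \<inter> \<nu> ` topspace T"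
      unfolding openin_subtopology by auto
    obtain C where C: "openin Y C" "closedin Y C" "\<nu> s0 \<in> C" "C \<subseteq> O'"
      using Stone_space_clopen_nbhd[OF Y O'(1), of "\<nu> s0"] O'(2) s0 by blast
    have inj: "inj_on \<nu> (topspace T)"
      using emb by (simp add: embedding_map_def homeomorphic_map_def homeomorphic_eq_everything_map)
    have CU: "s \<in> U" if "s \<in> carrier S" "\<nu> s \<in> C" for s
    proof -
      have "\<nu> s \<in> \<nu> ` U" using that C(4) O'(2) T by auto
      then show ?thesis
        using inj that(1) openin_subset[OF U] T by (metis inj_on_image_mem_iff)
    qed
    define f where "f = (\<lambda>a\<in>A. if \<nu> a \<in> C then \<one>\<^bsub>F\<^esub> else \<zero>\<^bsub>F\<^esub>)"
    have f: "f \<in> W"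
      unfolding f_def W_def pullback_functions_def mem_Collect_eq
      using continuous_map_clopen_indicator[OF C(1,2) F.one_closed F.zero_closed]
      by (intro exI[of _ "\<lambda>y. if y \<in> C then \<one>\<^bsub>F\<^esub> else \<zero>\<^bsub>F\<^esub>"]) simp
    let ?B = "M.mball (\<phi> s0 f) 1"
    \<comment> \<open>Evaluation at \<open>f\<close> is a coordinate projection of the pointwise
      topology, so \<open>?N\<close> is open. The radius 1 is the size of the jump of the indicator
      \<open>f\<close>.\<close>
    let ?N = "{\<sigma> \<in> topspace (Theta_lin_topology F V nrm). \<sigma> f \<in> ?B}"
    have "continuous_map (Theta_lin_topology F V nrm) (norm_topology V nrm) (\<lambda>\<sigma>. \<sigma> f)"
      unfolding Theta_lin_topology_def using f
      by (intro continuous_map_from_subtopology continuous_map_product_projection) (simp add: carrier_V)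
    then have "openin (Theta_lin_topology F V nrm) ?N"
      by (rule openin_continuous_map_preimage) (simp add: norm_topology_def)
    moreover have "\<phi> s0 \<in> ?N"
    proof -
      have "\<phi> s0 \<in> topspace (Theta_lin_topology F V nrm)"
        using cont s0S T by (auto simp: continuous_map_def)
      moreover have "\<phi> s0 f \<in> ?B"
        using \<phi>_closed[OF s0S f] carrier_V by (intro M.centre_in_mball_iff[THEN iffD2]) simp_all
      ultimately show ?thesis by simp
    qed
    moreover have "s \<in> U" if s: "s \<in> topspace T" and N: "\<phi> s \<in> ?N" for s
    proof (rule CU, use s T in simp, rule ccontr)
      assume sC: "\<nu> s \<notin> C"
      have sS: "s \<in> carrier S" using s T by simp
      let ?d = "\<phi> s0 f \<ominus>\<^bsub>V\<^esub> \<phi> s f"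
      have W: "\<phi> s0 f \<in> carrier V" "\<phi> s f \<in> carrier V"
        using \<phi>_closed f s0S sS by (simp_all add: carrier_V)
      then have d: "?d \<in> W" using V.minus_closed carrier_V by blast
      \<comment> \<open>Subtraction in \<open>V\<close> is given only through the abstract additive
        inverse; adding \<phi>\<open>s f\<close> back yields a sum, which can be evaluated
        pointwise.\<close>
      have "?d \<oplus>\<^bsub>V\<^esub> \<phi> s f = \<phi> s0 f"
        using W by (simp add: a_minus_def V.a_assoc V.l_neg)
      then have "(?d \<oplus>\<^bsub>V\<^esub> \<phi> s f) \<one>\<^bsub>S\<^esub> = \<phi> s0 f \<one>\<^bsub>S\<^esub>" by simp
      \<comment> \<open>At the unit the translates take the values \<open>f s\<close> and
        \<open>f s0\<close>, which are zero and one because \<open>C\<close> contains the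
        \<nu>-image of \<open>s0\<close> but not that of \<open>s\<close>.\<close>
      then have "?d \<one>\<^bsub>S\<^esub> \<oplus>\<^bsub>F\<^esub> f s = f s0"
        using f sS s0S by (simp add: V_def A_def \<phi>_def)
      moreover have "?d \<one>\<^bsub>S\<^esub> \<in> carrier F" using d closed by (auto simp: A_def)
      ultimately have "?d \<one>\<^bsub>S\<^esub> = \<one>\<^bsub>F\<^esub>"
        using sC C(3) sS s0S by (simp add: f_def A_def)
      then have "1 \<le> nrm ?d"
        using max_norm_ge[OF fin[OF d], of "\<one>\<^bsub>S\<^esub>" av] av_one by (simp add: nrm_def A_def)
      moreover have "nrm ?d < 1"
        using N W by (simp add: norm_dist_def)
      ultimately show False by simp
    qed
    ultimately show "\<exists>N. openin (Theta_lin_topology F V nrm) N \<and> \<phi> s0 \<in> N \<and>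
        (\<forall>s\<in>topspace T. \<phi> s \<in> N \<longrightarrow> s \<in> U)"
      by blast
  qed
  with hom one V show ?thesis
    unfolding topological_submonoid_def by blast
qed

end
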